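(* Suppose that $(X,a,f)$ is an oplax model of a monotone abstract GSOS specification $\lambda$, and $(Y,b,g)$ is a lax model of $\lambda$. Then the contextual closure $\mathsf{ctx}_{a,b}$ is $s$-respectful, i.e. for every relation $R \subseteq X \times Y$ we have $\mathsf{ctx}_{a,b}(s(R) \cap R) \subseteq s(\mathsf{ctx}_{a,b}(R)) \cap \mathsf{ctx}_{a,b}(R)$.
   Context: Let $B \colon \mathsf{Set} \to \mathsf{Set}$ be an ordered functor: for every set $X$ there is a preorder $\sqsubseteq_{BX}$ on $BX$ such that $Bh$ is monotone for every map $h$. A $B$-coalgebra is a pair $(X,f)$ with $f \colon X \to BX$. Relation lifting: for $R \subseteq X \times Y$ with projections $\pi_1,\pi_2$, $\mathrm{Rel}(B)(R) = \{(u,v) \mid \exists z \in B(R).\ B(\pi_1)(z)=u,\ B(\pi_2)(z)=v\}$. For $B$-coalgebras $(X,f)$ and $(Y,g)$, the simulation functional $s \colon \mathrm{Rel}_{X,Y} \to \mathrm{Rel}_{X,Y}$ is $s(R) = (f \times g)^{-1}\big({\sqsubseteq_{BX}} ; \mathrm{Rel}(B)(R) ; {\sqsubseteq_{BY}}\big)$ (";" = relational composition). Let $\Sigma$ be a signature, $H_\Sigma(X) = \coprod_{\sigma \in \Sigma} \{\sigma\} \times X^{\mathrm{ar}(\sigma)}$ its functor, and $T_\Sigma$ the free monad (terms over $\Sigma$ with variables in $X$). For an algebra $a \colon H_\Sigma X \to X$, $a^{*} \colon T_\Sigma X \to X$ is its unique extension to terms (the algebra homomorphism induced by $\mathrm{id}_X$).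 An abstract GSOS specification is a natural transformation $\lambda \colon H_\Sigma(B \times \mathrm{Id}) \Rightarrow B T_\Sigma$; it is monotone if for each $X$, $\sigma \in \Sigma$ of arity $n$, $u_i \sqsubseteq_{BX} v_i$ ($i=1..n$) and $x_i \in X$, we have $\lambda_X(\sigma((u_1,x_1),\dots,(u_n,x_n))) \sqsubseteq_{BT_\Sigma X} \lambda_X(\sigma((v_1,x_1),\dots,(v_n,x_n)))$. A triple $(X,a,f)$ with $a \colon H_\Sigma X \to X$ and $f \colon X \to BX$ is a lax $\lambda$-model if $f \circ a \sqsubseteq_{BX} Ba^{*} \circ \lambda_X \circ H_\Sigma\langle f, \mathrm{id}\rangle$ (pointwise), and an oplax $\lambda$-model if the reverse inequality $\sqsupseteq_{BX}$ holds. For algebras $a \colon H_\Sigma X \to X$ and $b \colon H_\Sigma Y \to Y$, the contextual closure is $\mathsf{ctx}_{a,b}(R) = \{(a^{*}(u), b^{*}(v)) \mid (u,v) \in \mathrm{Rel}(T_\Sigma)(R)\}$. A monotone map $h$ on relations is $s$-respectful if $h \circ (s \wedge \mathrm{id}) \le (s \wedge \mathrm{id}) \circ h$ pointwise.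
   Formalization: The inequalities defining lax and oplax models are exchanged: here lax means f∘a ⊒ Ba*∘λ_X∘H_Σ⟨f,id⟩ and oplax means ⊑; with the orientation given in the context the claim is false. *)

theory Defs
  imports Main "HOL-Library.FuncSet"
begin

section \<open>The category of sets\<close>

text \<open>
  HOL cannot quantify over type constructors, so \<open>Set\<close> is rendered as the category whose
  objects are all subsets (possibly empty) of the type \<open>('s, 'a) univ\<close> below and whose morphisms
  \<open>X \<rightarrow> Y\<close> are the functions in \<open>X \<rightarrow> Y\<close>, taken up to equality on \<open>X\<close>.
  The type consists of atoms from an arbitrary type \<open>'a\<close> and is freely closed under ordered pairs
  and under terms over operation symbols from \<open>'s\<close>. Hence relations between objects and sets
  of terms over an object are objects again.
  Any two given sets can be taken as sets of atoms, so no generality is lost.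
\<close>

datatype ('s, 'a) univ =
    Atom 'a
  | Tup (fst_of: "('s, 'a) univ") (snd_of: "('s, 'a) univ")
  | Var "('s, 'a) univ"
  | Op 's "('s, 'a) univ list"

text \<open>
  The values of a functor lie in an arbitrary further type \<open>'b\<close>, not in the universe itself:
  otherwise Cantor's theorem would exclude, e.g., the powerset functor. The morphism part takes
  domain and codomain as arguments, since a set functor need not preserve inclusions.
\<close>

locale set_functor =
  fixes B :: "'u set \<Rightarrow> 'b set"
    and Bm :: "'u set \<Rightarrow> 'u set \<Rightarrow> ('u \<Rightarrow> 'u) \<Rightarrow> 'b \<Rightarrow> 'b"
  assumes map_closed: "h \<in> X \<rightarrow> Y \<Longrightarrow> Bm X Y h \<in> B X \<rightarrow> B Y"
    and map_cong: "h \<in> X \<rightarrow> Y \<Longrightarrow> (\<And>x. x \<in> X \<Longrightarrow> h x = k x) \<Longrightarrow> u \<in> B X \<Longrightarrow> Bm X Y h u = Bm X Y k u"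
    and map_id: "u \<in> B X \<Longrightarrow> Bm X X (\<lambda>x. x) u = u"
    and map_comp: "h \<in> X \<rightarrow> Y \<Longrightarrow> k \<in> Y \<rightarrow> Z \<Longrightarrow> u \<in> B X \<Longrightarrow>
      Bm X Z (\<lambda>x. k (h x)) u = Bm Y Z k (Bm X Y h u)"

locale ordered_functor = set_functor B Bm
  for B :: "'u set \<Rightarrow> 'b set" and Bm +
  fixes le :: "'u set \<Rightarrow> 'b rel"
  assumes preorder: "preorder_on (B X) (le X)"
    and map_mono: "h \<in> X \<rightarrow> Y \<Longrightarrow> (u, v) \<in> le X \<Longrightarrow> (Bm X Y h u, Bm X Y h v) \<in> le Y"

section \<open>Relation lifting and simulation\<close>

definition rel_obj :: "('s, 'a) univ rel \<Rightarrow> ('s, 'a) univ set" where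
  "rel_obj R = {Tup x y | x y. (x, y) \<in> R}"

definition rel_lift ::
  "(('s, 'a) univ set \<Rightarrow> 'b set) \<Rightarrow>
   (('s, 'a) univ set \<Rightarrow> ('s, 'a) univ set \<Rightarrow> (('s, 'a) univ \<Rightarrow> ('s, 'a) univ) \<Rightarrow> 'b \<Rightarrow> 'b) \<Rightarrow>
   ('s, 'a) univ set \<Rightarrow> ('s, 'a) univ set \<Rightarrow> ('s, 'a) univ rel \<Rightarrow> 'b rel" where
  "rel_lift F Fm X Y R =
     {(u, v). \<exists>z \<in> F (rel_obj R). Fm (rel_obj R) X fst_of z = u \<and> Fm (rel_obj R) Y snd_of z = v}"

definition simul ::
  "(('s, 'a) univ set \<Rightarrow> 'b set) \<Rightarrow>
   (('s, 'a) univ set \<Rightarrow> ('s, 'a) univ set \<Rightarrow> (('s, 'a) univ \<Rightarrow> ('s, 'a) univ) \<Rightarrow> 'b \<Rightarrow> 'b) \<Rightarrow>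
   (('s, 'a) univ set \<Rightarrow> 'b rel) \<Rightarrow>
   ('s, 'a) univ set \<Rightarrow> (('s, 'a) univ \<Rightarrow> 'b) \<Rightarrow>
   ('s, 'a) univ set \<Rightarrow> (('s, 'a) univ \<Rightarrow> 'b) \<Rightarrow>
   ('s, 'a) univ rel \<Rightarrow> ('s, 'a) univ rel" where
  "simul B Bm le X f Y g R =
     {(x, y) \<in> X \<times> Y. (f x, g y) \<in> le X O rel_lift B Bm X Y R O le Y}"

section \<open>Signatures, terms and algebras\<close>

text \<open>
  A signature is a set \<open>Sig\<close> of operation symbols with finite arities \<open>ar\<close>;
  an element \<open>\<sigma>(z\<^sub>1, \<dots>, z\<^sub>n)\<close> of \<open>H\<^sub>\<Sigma> Z\<close> is the pair of \<open>\<sigma>\<close> and the list of its arguments.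
\<close>

definition sig :: "'s set \<Rightarrow> ('s \<Rightarrow> nat) \<Rightarrow> 'z set \<Rightarrow> ('s \<times> 'z list) set" where
  "sig Sig ar Z = {(\<sigma>, zs). \<sigma> \<in> Sig \<and> length zs = ar \<sigma> \<and> set zs \<subseteq> Z}"

definition sig_map :: "('z \<Rightarrow> 'w) \<Rightarrow> 's \<times> 'z list \<Rightarrow> 's \<times> 'w list" where
  "sig_map h = map_prod id (map h)"

inductive_set trms :: "'s set \<Rightarrow> ('s \<Rightarrow> nat) \<Rightarrow> ('s, 'a) univ set \<Rightarrow> ('s, 'a) univ set"
  for Sig ar X where
  Var: "x \<in> X \<Longrightarrow> Var x \<in> trms Sig ar X"
| Op: "\<sigma> \<in> Sig \<Longrightarrow> length ts = ar \<sigma> \<Longrightarrow> \<forall>t \<in> set ts. t \<in> trms Sig ar X \<Longrightarrow> Op \<sigma> ts \<in> trms Sig ar X"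

text \<open>The arguments of \<open>Var\<close> are not traversed in the following recursions, even if they
  happen to be terms themselves.\<close>

primrec trm_map :: "(('s, 'a) univ \<Rightarrow> ('s, 'a) univ) \<Rightarrow> ('s, 'a) univ \<Rightarrow> ('s, 'a) univ" where
  "trm_map h (Atom c) = undefined"
| "trm_map h (Tup x y) = undefined"
| "trm_map h (Var x) = Var (h x)"
| "trm_map h (Op \<sigma> ts) = Op \<sigma> (map (trm_map h) ts)"

primrec trm_ext :: "('s \<times> ('s, 'a) univ list \<Rightarrow> ('s, 'a) univ) \<Rightarrow> ('s, 'a) univ \<Rightarrow> ('s, 'a) univ" where
  "trm_ext a (Atom c) = undefined"
| "trm_ext a (Tup x y) = undefined"
| "trm_ext a (Var x) = x"
| "trm_ext a (Op \<sigma> ts) = a (\<sigma>, map (trm_ext a) ts)"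

definition ctx ::
  "'s set \<Rightarrow> ('s \<Rightarrow> nat) \<Rightarrow>
   ('s, 'a) univ set \<Rightarrow> ('s \<times> ('s, 'a) univ list \<Rightarrow> ('s, 'a) univ) \<Rightarrow>
   ('s, 'a) univ set \<Rightarrow> ('s \<times> ('s, 'a) univ list \<Rightarrow> ('s, 'a) univ) \<Rightarrow>
   ('s, 'a) univ rel \<Rightarrow> ('s, 'a) univ rel" where
  "ctx Sig ar X a Y b R =
     {(trm_ext a u, trm_ext b v) | u v. (u, v) \<in> rel_lift (trms Sig ar) (\<lambda>_ _. trm_map) X Y R}"

section \<open>Monotone abstract GSOS specifications and their lax models\<close>

locale monotone_gsos = ordered_functor B Bm le
  for B :: "('s, 'a) univ set \<Rightarrow> 'b set" and Bm le +
  fixes Sig :: "'s set" and ar :: "'s \<Rightarrow> nat"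
    and lam :: "('s, 'a) univ set \<Rightarrow> 's \<times> ('b \<times> ('s, 'a) univ) list \<Rightarrow> 'b"
  assumes lam_closed: "lam X \<in> sig Sig ar (B X \<times> X) \<rightarrow> B (trms Sig ar X)"
    and lam_natural: "h \<in> X \<rightarrow> Y \<Longrightarrow> t \<in> sig Sig ar (B X \<times> X) \<Longrightarrow>
      lam Y (sig_map (map_prod (Bm X Y h) h) t) =
        Bm (trms Sig ar X) (trms Sig ar Y) (trm_map h) (lam X t)"
    and lam_mono: "\<sigma> \<in> Sig \<Longrightarrow> length us = ar \<sigma> \<Longrightarrow> length vs = ar \<sigma> \<Longrightarrow> length xs = ar \<sigma> \<Longrightarrow>
      (\<forall>i < ar \<sigma>. (us ! i, vs ! i) \<in> le X \<and> xs ! i \<in> X) \<Longrightarrow>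
      (lam X (\<sigma>, zip us xs), lam X (\<sigma>, zip vs xs)) \<in> le (trms Sig ar X)"

text \<open>
  \<open>derived\<close> is the composite \<open>Ba\<^sup>* \<circ> \<lambda>\<^sub>X \<circ> H\<^sub>\<Sigma>\<langle>f, id\<rangle>\<close>, the behaviour prescribed by the rules.

  Orientation: in a lax model the rules are sound, so the behaviour of \<open>\<sigma>(x\<^sub>1, \<dots>, x\<^sub>n)\<close> is above the
  prescribed one; in an oplax model it is below. With the two names exchanged, contextual closure
  from an oplax to a lax model is not respectful: let \<open>B\<close> be constantly \<open>{0, 1}\<close> with
  \<open>0 \<sqsubseteq> 1\<close>, let \<open>c\<close> be a single constant with prescribed behaviour \<open>0\<close>, and let \<open>X\<close> and \<open>Y\<close> be
  singletons with \<open>f = 1\<close> and \<open>g = 0\<close>. Then \<open>f\<close> is above and \<open>g\<close> is below the prescribed behaviour,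
  and the closure of the empty relation is \<open>X \<times> Y\<close>, which is not contained in \<open>s(X \<times> Y) = {}\<close>.
\<close>

definition derived ::
  "(('s, 'a) univ set \<Rightarrow> ('s, 'a) univ set \<Rightarrow> (('s, 'a) univ \<Rightarrow> ('s, 'a) univ) \<Rightarrow> 'b \<Rightarrow> 'b) \<Rightarrow>
   's set \<Rightarrow> ('s \<Rightarrow> nat) \<Rightarrow>
   (('s, 'a) univ set \<Rightarrow> 's \<times> ('b \<times> ('s, 'a) univ) list \<Rightarrow> 'b) \<Rightarrow>
   ('s, 'a) univ set \<Rightarrow> ('s \<times> ('s, 'a) univ list \<Rightarrow> ('s, 'a) univ) \<Rightarrow> (('s, 'a) univ \<Rightarrow> 'b) \<Rightarrow>
   's \<times> ('s, 'a) univ list \<Rightarrow> 'b" where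
  "derived Bm Sig ar lam X a f t =
     Bm (trms Sig ar X) X (trm_ext a) (lam X (sig_map (\<lambda>x. (f x, x)) t))"

definition lax_model ::
  "(('s, 'a) univ set \<Rightarrow> 'b set) \<Rightarrow>
   (('s, 'a) univ set \<Rightarrow> ('s, 'a) univ set \<Rightarrow> (('s, 'a) univ \<Rightarrow> ('s, 'a) univ) \<Rightarrow> 'b \<Rightarrow> 'b) \<Rightarrow>
   (('s, 'a) univ set \<Rightarrow> 'b rel) \<Rightarrow> 's set \<Rightarrow> ('s \<Rightarrow> nat) \<Rightarrow>
   (('s, 'a) univ set \<Rightarrow> 's \<times> ('b \<times> ('s, 'a) univ) list \<Rightarrow> 'b) \<Rightarrow>
   ('s, 'a) univ set \<Rightarrow> ('s \<times> ('s, 'a) univ list \<Rightarrow> ('s, 'a) univ) \<Rightarrow> (('s, 'a) univ \<Rightarrow> 'b) \<Rightarrow> bool" where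
  "lax_model B Bm le Sig ar lam X a f \<longleftrightarrow>
     a \<in> sig Sig ar X \<rightarrow> X \<and> f \<in> X \<rightarrow> B X \<and>
     (\<forall>t \<in> sig Sig ar X. (derived Bm Sig ar lam X a f t, f (a t)) \<in> le X)"

definition oplax_model ::
  "(('s, 'a) univ set \<Rightarrow> 'b set) \<Rightarrow>
   (('s, 'a) univ set \<Rightarrow> ('s, 'a) univ set \<Rightarrow> (('s, 'a) univ \<Rightarrow> ('s, 'a) univ) \<Rightarrow> 'b \<Rightarrow> 'b) \<Rightarrow>
   (('s, 'a) univ set \<Rightarrow> 'b rel) \<Rightarrow> 's set \<Rightarrow> ('s \<Rightarrow> nat) \<Rightarrow>
   (('s, 'a) univ set \<Rightarrow> 's \<times> ('b \<times> ('s, 'a) univ) list \<Rightarrow> 'b) \<Rightarrow>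
   ('s, 'a) univ set \<Rightarrow> ('s \<times> ('s, 'a) univ list \<Rightarrow> ('s, 'a) univ) \<Rightarrow> (('s, 'a) univ \<Rightarrow> 'b) \<Rightarrow> bool" where
  "oplax_model B Bm le Sig ar lam X a f \<longleftrightarrow>
     a \<in> sig Sig ar X \<rightarrow> X \<and> f \<in> X \<rightarrow> B X \<and>
     (\<forall>t \<in> sig Sig ar X. (f (a t), derived Bm Sig ar lam X a f t) \<in> le X)"

section \<open>Respectful functions\<close>

text \<open>The function \<open>h\<close> is a monotone endomap of the lattice of relations between \<open>X\<close> and \<open>Y\<close>.\<close>

definition respectful :: "'u set \<Rightarrow> 'u set \<Rightarrow> ('u rel \<Rightarrow> 'u rel) \<Rightarrow> ('u rel \<Rightarrow> 'u rel) \<Rightarrow> bool" where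
  "respectful X Y s h \<longleftrightarrow>
     h \<in> Pow (X \<times> Y) \<rightarrow> Pow (X \<times> Y) \<and> mono_on (Pow (X \<times> Y)) h \<and>
     (\<forall>R \<subseteq> X \<times> Y. h (s R \<inter> R) \<subseteq> s (h R) \<inter> h R)"

end

theory Submission
  imports Defs
begin

text \<open>
  Elements of \<open>ctx R\<close> are the values of terms over \<open>R\<close>, so one argues by induction on such terms.
  For an operation symbol, the simulation witnesses of its arguments, combined by \<open>\<lambda>\<close> at the
  object \<open>ctx R\<close>, give an element of \<open>B (T\<^sub>\<Sigma> (ctx R))\<close>. Evaluating terms over \<open>ctx R\<close> componentwise
  maps it to \<open>B (ctx R)\<close>, because \<open>ctx R\<close> is a subalgebra of the product algebra. By naturality its
  two projections are the prescribed behaviours computed from the bounds on the arguments;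
  monotonicity of \<open>\<lambda>\<close> and the model inequalities compare these with the actual behaviours.
\<close>

lemma trm_map_in_trms:
  assumes "t \<in> trms Sig ar X" and "h \<in> X \<rightarrow> Y"
  shows "trm_map h t \<in> trms Sig ar Y"
  using assms by (induction rule: trms.induct) (auto intro!: trms.intros)

lemma trm_ext_closed:
  assumes "t \<in> trms Sig ar X" and "a \<in> sig Sig ar X \<rightarrow> X"
  shows "trm_ext a t \<in> X"
  using assms
proof (induction rule: trms.induct)
  case (Op \<sigma> ts)
  then have "(\<sigma>, map (trm_ext a) ts) \<in> sig Sig ar X"
    by (auto simp: sig_def)
  with Op.prems show ?case by auto
qed simp

lemma trms_mono: "X \<subseteq> Y \<Longrightarrow> trms Sig ar X \<subseteq> trms Sig ar Y"
proof
  fix t assume "X \<subseteq> Y" "t \<in> trms Sig ar X"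
  from this(2,1) show "t \<in> trms Sig ar Y"
    by (induction rule: trms.induct) (auto intro!: trms.intros)
qed

lemma rel_obj_mono: "R \<subseteq> S \<Longrightarrow> rel_obj R \<subseteq> rel_obj S"
  by (auto simp: rel_obj_def)

lemma Tup_in_rel_obj [simp]: "Tup x y \<in> rel_obj R \<longleftrightarrow> (x, y) \<in> R"
  by (simp add: rel_obj_def)

lemma fst_of_rel_obj: "R \<subseteq> X \<times> Y \<Longrightarrow> fst_of \<in> rel_obj R \<rightarrow> X"
  and snd_of_rel_obj: "R \<subseteq> X \<times> Y \<Longrightarrow> snd_of \<in> rel_obj R \<rightarrow> Y"
  by (auto simp: rel_obj_def)

text \<open>A lifted pair of terms consists of the two projections of one term over
  \<open>rel_obj R\<close>, so the closure can be treated by induction on that single term.\<close>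

lemma ctx_eq_image:
  "ctx Sig ar X a Y b R =
     (\<lambda>z. (trm_ext a (trm_map fst_of z), trm_ext b (trm_map snd_of z))) ` trms Sig ar (rel_obj R)"
  by (auto simp: ctx_def rel_lift_def)

lemma ctx_mono: "R \<subseteq> S \<Longrightarrow> ctx Sig ar X a Y b R \<subseteq> ctx Sig ar X a Y b S"
  unfolding ctx_eq_image by (intro image_mono trms_mono rel_obj_mono)

lemma ctx_subset:
  assumes "R \<subseteq> X \<times> Y" and "a \<in> sig Sig ar X \<rightarrow> X" and "b \<in> sig Sig ar Y \<rightarrow> Y"
  shows "ctx Sig ar X a Y b R \<subseteq> X \<times> Y"
  unfolding ctx_eq_image
  by (intro image_subsetI SigmaI
      trm_ext_closed[OF trm_map_in_trms[OF _ fst_of_rel_obj[OF assms(1)]] assms(2)]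
      trm_ext_closed[OF trm_map_in_trms[OF _ snd_of_rel_obj[OF assms(1)]] assms(3)])

lemma subset_ctx: "R \<subseteq> ctx Sig ar X a Y b R"
proof clarify
  fix x y assume "(x, y) \<in> R"
  then have "Var (Tup x y) \<in> trms Sig ar (rel_obj R)" by (auto intro: trms.Var)
  then show "(x, y) \<in> ctx Sig ar X a Y b R"
    unfolding ctx_eq_image by (rule rev_image_eqI) simp
qed

lemma ctx_Op:
  assumes "\<sigma> \<in> Sig" and "length ps = ar \<sigma>" and "set ps \<subseteq> ctx Sig ar X a Y b R"
  shows "(a (\<sigma>, map fst ps), b (\<sigma>, map snd ps)) \<in> ctx Sig ar X a Y b R"
proof -
  let ?e = "\<lambda>z. (trm_ext a (trm_map fst_of z), trm_ext b (trm_map snd_of z))"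
  \<comment> \<open>Through \<open>lists_image\<close>, representing terms for all entries of
    \<open>ps\<close> come at once as a list \<open>zs\<close>; \<open>Op \<sigma> zs\<close> then
    represents the new pair.\<close>
  have "ps \<in> lists (?e ` trms Sig ar (rel_obj R))"
    using assms(3) by (auto simp: ctx_eq_image)
  then obtain zs where zs: "set zs \<subseteq> trms Sig ar (rel_obj R)" "ps = map ?e zs"
    unfolding lists_image by auto
  have "Op \<sigma> zs \<in> trms Sig ar (rel_obj R)"
    using assms zs by (auto intro!: trms.Op)
  then show ?thesis
    unfolding ctx_eq_image by (rule rev_image_eqI) (simp add: zs o_def)
qed

text \<open>Structural induction on a representing term over \<open>rel_obj R\<close>, with
  variables giving the base case. Immediate subterms represent the argument pairs, so these lie in
  the closure as well.\<close>

lemma ctx_induct [consumes 1, case_names base Op]: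
  assumes "(x, y) \<in> ctx Sig ar X a Y b R"
    and base: "\<And>x y. (x, y) \<in> R \<Longrightarrow> P x y"
    and Op: "\<And>\<sigma> ps. \<sigma> \<in> Sig \<Longrightarrow> length ps = ar \<sigma> \<Longrightarrow>
      (\<And>x y. (x, y) \<in> set ps \<Longrightarrow> (x, y) \<in> ctx Sig ar X a Y b R \<and> P x y) \<Longrightarrow>
      P (a (\<sigma>, map fst ps)) (b (\<sigma>, map snd ps))"
  shows "P x y"
proof -
  let ?e = "\<lambda>z. (trm_ext a (trm_map fst_of z), trm_ext b (trm_map snd_of z))"
  have "P (fst (?e z)) (snd (?e z))" if "z \<in> trms Sig ar (rel_obj R)" for z
    using that
  proof (induction rule: trms.induct)
    case (Var z)
    then show ?case using base by (auto simp: rel_obj_def)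
  next
    case (Op \<sigma> zs)
    have "P (a (\<sigma>, map fst (map ?e zs))) (b (\<sigma>, map snd (map ?e zs)))"
      using Op by (intro assms(3)) (auto simp: ctx_eq_image)
    then show ?case by (simp add: o_def)
  qed
  with assms(1) show ?thesis by (auto simp: ctx_eq_image)
qed

text \<open>A term whose variables are values of terms can be flattened; in the induction this is
  closure under operations, \<open>ctx_Op\<close>.\<close>

lemma ctx_idem: "ctx Sig ar X a Y b (ctx Sig ar X a Y b R) = ctx Sig ar X a Y b R"
proof
  show "ctx Sig ar X a Y b (ctx Sig ar X a Y b R) \<subseteq> ctx Sig ar X a Y b R"
  proof clarify
    fix x y assume "(x, y) \<in> ctx Sig ar X a Y b (ctx Sig ar X a Y b R)"
    then show "(x, y) \<in> ctx Sig ar X a Y b R"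
      by (induction rule: ctx_induct) (auto intro!: ctx_Op)
  qed
qed (rule subset_ctx)

context ordered_functor
begin

lemma le_trans: "(u, v) \<in> le X \<Longrightarrow> (v, w) \<in> le X \<Longrightarrow> (u, w) \<in> le X"
  using preorder[of X] by (auto simp: preorder_on_def dest: transD)

end

lemma simul_iff:
  "(x, y) \<in> simul B Bm le X f Y g R \<longleftrightarrow>
     x \<in> X \<and> y \<in> Y \<and> (\<exists>z \<in> B (rel_obj R). (f x, Bm (rel_obj R) X fst_of z) \<in> le X \<and>
       (Bm (rel_obj R) Y snd_of z, g y) \<in> le Y)"
  by (auto simp: simul_def rel_lift_def)

context monotone_gsos
begin

text \<open>\<open>B\<close> need not preserve inclusions, so the witness is transported along the
  image under \<open>B\<close> of the inclusion of \<open>rel_obj R\<close> into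
  \<open>rel_obj S\<close>. Functoriality leaves its projections unchanged.\<close>

lemma simul_mono:
  assumes "R \<subseteq> S" and S: "S \<subseteq> X \<times> Y"
  shows "simul B Bm le X f Y g R \<subseteq> simul B Bm le X f Y g S"
proof clarify
  fix x y assume "(x, y) \<in> simul B Bm le X f Y g R"
  then obtain z where xy: "x \<in> X" "y \<in> Y" and z: "z \<in> B (rel_obj R)"
    and le: "(f x, Bm (rel_obj R) X fst_of z) \<in> le X" "(Bm (rel_obj R) Y snd_of z, g y) \<in> le Y"
    by (auto simp: simul_iff)
  have incl: "(\<lambda>p. p) \<in> rel_obj R \<rightarrow> rel_obj S"
    using rel_obj_mono[OF assms(1)] by auto
  let ?z = "Bm (rel_obj R) (rel_obj S) (\<lambda>p. p) z"
  have "?z \<in> B (rel_obj S)" using map_closed[OF incl] z by auto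
  moreover have "Bm (rel_obj S) X fst_of ?z = Bm (rel_obj R) X fst_of z"
    "Bm (rel_obj S) Y snd_of ?z = Bm (rel_obj R) Y snd_of z"
    using map_comp[OF incl fst_of_rel_obj[OF S] z] map_comp[OF incl snd_of_rel_obj[OF S] z]
    by simp_all
  ultimately show "(x, y) \<in> simul B Bm le X f Y g S"
    using xy le unfolding simul_iff by metis
qed

text \<open>Naturality of \<open>lam\<close> at \<open>h\<close>, then functoriality of
  \<open>B\<close>. With \<open>h\<close> a projection of \<open>rel_obj R\<close>, this moves the
  computation from \<open>X\<close> or \<open>Y\<close> to pairs.\<close>

lemma Bm_trm_ext_lam:
  assumes h: "h \<in> Z \<rightarrow> X" and a: "a \<in> sig Sig ar X \<rightarrow> X"
    and t: "t \<in> sig Sig ar (B Z \<times> Z)"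
  shows "Bm (trms Sig ar X) X (trm_ext a) (lam X (sig_map (map_prod (Bm Z X h) h) t)) =
    Bm (trms Sig ar Z) X (\<lambda>s. trm_ext a (trm_map h s)) (lam Z t)"
proof -
  have "lam Z t \<in> B (trms Sig ar Z)" using lam_closed t by auto
  moreover have "trm_map h \<in> trms Sig ar Z \<rightarrow> trms Sig ar X"
    using h by (auto intro: trm_map_in_trms)
  moreover have "trm_ext a \<in> trms Sig ar X \<rightarrow> X"
    using a by (auto intro: trm_ext_closed)
  ultimately show ?thesis
    using map_comp lam_natural[OF h t] by metis
qed

lemma Bm_lam_mono:
  assumes \<sigma>: "\<sigma> \<in> Sig" "length ps = ar \<sigma>" and a: "a \<in> sig Sig ar X \<rightarrow> X"
    and le: "\<And>p. p \<in> set ps \<Longrightarrow> (u p, v p) \<in> le X \<and> k p \<in> X"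
  shows "(Bm (trms Sig ar X) X (trm_ext a) (lam X (\<sigma>, map (\<lambda>p. (u p, k p)) ps)),
          Bm (trms Sig ar X) X (trm_ext a) (lam X (\<sigma>, map (\<lambda>p. (v p, k p)) ps))) \<in> le X"
proof (rule map_mono)
  show "trm_ext a \<in> trms Sig ar X \<rightarrow> X" using a by (auto intro: trm_ext_closed)
  have "(lam X (\<sigma>, zip (map u ps) (map k ps)), lam X (\<sigma>, zip (map v ps) (map k ps)))
      \<in> le (trms Sig ar X)"
    using \<sigma> le by (intro lam_mono) auto
  then show "(lam X (\<sigma>, map (\<lambda>p. (u p, k p)) ps), lam X (\<sigma>, map (\<lambda>p. (v p, k p)) ps))
      \<in> le (trms Sig ar X)"
    by (simp add: zip_map_map zip_same_conv_map o_def)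
qed

text \<open>Closedness of \<open>R\<close> under \<open>ctx\<close> makes evaluation of terms over
  \<open>rel_obj R\<close> land in \<open>rel_obj R\<close> again, so no larger relation is needed
  for the witness.\<close>

lemma simul_Op:
  assumes oplax: "oplax_model B Bm le Sig ar lam X a f"
    and lax: "lax_model B Bm le Sig ar lam Y b g"
    and R: "R \<subseteq> X \<times> Y"
    and subalgebra: "ctx Sig ar X a Y b R \<subseteq> R"
    and \<sigma>: "\<sigma> \<in> Sig" "length ps = ar \<sigma>"
    and ps: "set ps \<subseteq> simul B Bm le X f Y g R \<inter> R"
  shows "(a (\<sigma>, map fst ps), b (\<sigma>, map snd ps)) \<in> simul B Bm le X f Y g R"
proof -
  let ?Z = "rel_obj R"
  have a: "a \<in> sig Sig ar X \<rightarrow> X" and b: "b \<in> sig Sig ar Y \<rightarrow> Y"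
    using oplax lax by (auto simp: oplax_model_def lax_model_def)
  have "\<forall>p \<in> set ps. \<exists>w. w \<in> B ?Z \<and> (f (fst p), Bm ?Z X fst_of w) \<in> le X \<and>
      (Bm ?Z Y snd_of w, g (snd p)) \<in> le Y"
    using ps by (force simp: simul_iff)
  then obtain w where w: "\<And>p. p \<in> set ps \<Longrightarrow> w p \<in> B ?Z"
    "\<And>p. p \<in> set ps \<Longrightarrow> (f (fst p), Bm ?Z X fst_of (w p)) \<in> le X"
    "\<And>p. p \<in> set ps \<Longrightarrow> (Bm ?Z Y snd_of (w p), g (snd p)) \<in> le Y"
    by metis
  \<comment> \<open>\<open>lam\<close> needs a behaviour and a state for each argument: the
    simulation supplies \<open>w p\<close>, and membership in \<open>R\<close> makes the pair itself
    a state. This is where the intersection with \<open>R\<close> enters.\<close>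
  let ?t = "(\<sigma>, map (\<lambda>p. (w p, Tup (fst p) (snd p))) ps)"
  have t: "?t \<in> sig Sig ar (B ?Z \<times> ?Z)"
    using \<sigma> w(1) ps by (auto simp: sig_def)
  have X: "fst p \<in> X" and Y: "snd p \<in> Y" if "p \<in> set ps" for p
    using that ps R by force+
  have sX: "(\<sigma>, map fst ps) \<in> sig Sig ar X" and sY: "(\<sigma>, map snd ps) \<in> sig Sig ar Y"
    using \<sigma> X Y by (auto simp: sig_def)
  let ?h = "\<lambda>s. trm_ext a (trm_map fst_of s)" and ?k = "\<lambda>s. trm_ext b (trm_map snd_of s)"
  \<comment> \<open>Evaluation in the product algebra; by \<open>ctx_eq_image\<close> its values are
    exactly the pairs in \<open>ctx R\<close>.\<close>
  let ?e = "\<lambda>s. Tup (?h s) (?k s)"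
  have e: "?e \<in> trms Sig ar ?Z \<rightarrow> ?Z"
    using subalgebra by (auto simp: ctx_eq_image)
  have l: "lam ?Z ?t \<in> B (trms Sig ar ?Z)" using lam_closed t by auto
  let ?z = "Bm (trms Sig ar ?Z) ?Z ?e (lam ?Z ?t)"
  have z: "?z \<in> B ?Z" using map_closed[OF e] l by auto
  \<comment> \<open>Since \<open>fst_of\<close> after \<open>?e\<close> is \<open>?h\<close>, both
    sides equal the image of \<open>lam ?Z ?t\<close> under \<open>?h\<close>.\<close>
  have fst_z: "Bm ?Z X fst_of ?z = Bm (trms Sig ar X) X (trm_ext a)
      (lam X (\<sigma>, map (\<lambda>p. (Bm ?Z X fst_of (w p), fst p)) ps))"
    using map_comp[OF e fst_of_rel_obj[OF R] l] Bm_trm_ext_lam[OF fst_of_rel_obj[OF R] a t]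
    by (simp add: sig_map_def o_def)
  have snd_z: "Bm ?Z Y snd_of ?z = Bm (trms Sig ar Y) Y (trm_ext b)
      (lam Y (\<sigma>, map (\<lambda>p. (Bm ?Z Y snd_of (w p), snd p)) ps))"
    using map_comp[OF e snd_of_rel_obj[OF R] l] Bm_trm_ext_lam[OF snd_of_rel_obj[OF R] b t]
    by (simp add: sig_map_def o_def)
  have f_le: "(f (a (\<sigma>, map fst ps)), derived Bm Sig ar lam X a f (\<sigma>, map fst ps)) \<in> le X"
    using oplax sX by (auto simp: oplax_model_def)
  have le_z: "(derived Bm Sig ar lam X a f (\<sigma>, map fst ps), Bm ?Z X fst_of ?z) \<in> le X"
    using Bm_lam_mono[OF \<sigma> a, of "\<lambda>p. f (fst p)" "\<lambda>p. Bm ?Z X fst_of (w p)" fst] w(2) X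
    unfolding fst_z by (simp add: derived_def sig_map_def o_def)
  have le_g: "(derived Bm Sig ar lam Y b g (\<sigma>, map snd ps), g (b (\<sigma>, map snd ps))) \<in> le Y"
    using lax sY by (auto simp: lax_model_def)
  have z_le: "(Bm ?Z Y snd_of ?z, derived Bm Sig ar lam Y b g (\<sigma>, map snd ps)) \<in> le Y"
    using Bm_lam_mono[OF \<sigma> b, of "\<lambda>p. Bm ?Z Y snd_of (w p)" "\<lambda>p. g (snd p)" snd] w(3) Y
    unfolding snd_z by (simp add: derived_def sig_map_def o_def)
  have "(f (a (\<sigma>, map fst ps)), Bm ?Z X fst_of ?z) \<in> le X"
    "(Bm ?Z Y snd_of ?z, g (b (\<sigma>, map snd ps))) \<in> le Y"
    using le_trans[OF f_le le_z] le_trans[OF z_le le_g] .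
  moreover have "a (\<sigma>, map fst ps) \<in> X" "b (\<sigma>, map snd ps) \<in> Y"
    using a b sX sY by auto
  ultimately show ?thesis
    unfolding simul_iff using z by (intro conjI bexI[of _ ?z])
qed

end

theorem theorem13:
  fixes B :: "('s, 'a) univ set \<Rightarrow> 'b set"
  assumes "monotone_gsos B Bm le Sig ar lam"
    and "oplax_model B Bm le Sig ar lam X a f"
    and "lax_model B Bm le Sig ar lam Y b g"
  shows "respectful X Y (simul B Bm le X f Y g) (ctx Sig ar X a Y b)"
proof -
  interpret monotone_gsos B Bm le Sig ar lam by fact
  let ?s = "simul B Bm le X f Y g" and ?c = "ctx Sig ar X a Y b"
  have a: "a \<in> sig Sig ar X \<rightarrow> X" and b: "b \<in> sig Sig ar Y \<rightarrow> Y"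
    using assms(2,3) by (auto simp: oplax_model_def lax_model_def)
  have "(x, y) \<in> ?s (?c R)" if R: "R \<subseteq> X \<times> Y" and "(x, y) \<in> ?c (?s R \<inter> R)" for R x y
    using that(2)
  proof (induction rule: ctx_induct)
    case (base x y)
    \<comment> \<open>The pair already lies in \<open>?s R\<close>, and \<open>R\<close> is
      contained in \<open>?c R\<close>.\<close>
    then show ?case using simul_mono[OF subset_ctx ctx_subset[OF R a b]] by auto
  next
    case (Op \<sigma> ps)
    \<comment> \<open>The induction hypothesis gives the first component; the second follows from
      membership in \<open>?c (?s R \<inter> R)\<close> by monotonicity of
      \<open>?c\<close>.\<close>
    then have "set ps \<subseteq> ?s (?c R) \<inter> ?c R"
      using ctx_mono[of "?s R \<inter> R" R Sig ar X a Y b] by auto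
    then show ?case
      using Op(1,2) by (intro simul_Op[OF assms(2,3) ctx_subset[OF R a b]]) (simp_all add: ctx_idem)
  qed
  moreover have "?c (?s R \<inter> R) \<subseteq> ?c R" for R
    by (rule ctx_mono) simp
  ultimately have "?c (?s R \<inter> R) \<subseteq> ?s (?c R) \<inter> ?c R" if "R \<subseteq> X \<times> Y" for R
    using that by auto
  then show ?thesis
    unfolding respectful_def
    using ctx_subset[OF _ a b] by (auto intro!: mono_onI ctx_mono)
qed

end
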